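(* Let $0<r<1$ and $R(r,1)=\{z\in\mathbb{C} : r<|z|<1\}$. Let $x,y\in R(r,1)$ be distinct points, and let $x_0,y_0,x_1,y_1$ be the points obtained from $x,y$ by the Euclidean midpoint rotation (see context). If $x_1,y_1$ both lie in $R(r,1)$ (so that $s_{R(r,1)}(x_1,y_1)$ is well-defined), then $$s_{R(r,1)}(x_0,y_0)\leq s_{R(r,1)}(x,y)\leq s_{R(r,1)}(x_1,y_1).$$ Otherwise, the first inequality $s_{R(r,1)}(x_0,y_0)\leq s_{R(r,1)}(x,y)$ still holds, and the points $x,y$ can be rotated around their Euclidean midpoint $k=(x+y)/2$ into new points $x',y'\in R(r,1)$ (that is, $x',y'\in S^1(k,|x-y|/2)$ with $(x'+y')/2=k$) for which $s_{R(r,1)}(x',y')$ is arbitrarily close to $1$.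
   Context: $S^1(k,q)$ is the Euclidean circle with center $k$ and radius $q$ in $\mathbb{R}^2=\mathbb{C}$. Triangular ratio metric: for a domain $G\subsetneq\mathbb{R}^n$ and $x,y\in G$, $s_G(x,y)=\dfrac{|x-y|}{\inf_{z\in\partial G}(|x-z|+|z-y|)}\in[0,1]$. Euclidean midpoint rotation: for distinct $x,y\in\mathbb{R}^2$, put $k=(x+y)/2$ and $q=|x-k|=|y-k|$. The points $x_0,y_0,x_1,y_1\in S^1(k,q)$ are chosen so that $(x_0+y_0)/2=(x_1+y_1)/2=k$, $|x_0|=|y_0|$, $|x_1|=|k|+q$ and $|y_1|=|k|-q$. (If $|k|<q$, no point $y_1$ with $|y_1|=|k|-q$ exists, and then $s_{R(r,1)}(x_1,y_1)$ is regarded as not well-defined.) If $x,y\in R(r,1)$, then $x_0,y_0\in R(r,1)$, but $x_1$ or $y_1$ may fail to lie in $R(r,1)$. *)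

theory Defs
  imports "HOL-Analysis.Analysis"
begin

text \<open>
  The triangular ratio metric of a domain \<open>G\<close> that is a proper subset of \<open>\<real>\<^sup>n\<close>, for points of \<open>G\<close>;
  such a \<open>G\<close> has nonempty frontier, so the infimum is over a nonempty set bounded below by 0.
\<close>

definition triangular_ratio :: "'a::euclidean_space set \<Rightarrow> 'a \<Rightarrow> 'a \<Rightarrow> real" where
  "triangular_ratio G x y = dist x y / (INF z\<in>frontier G. dist x z + dist z y)"

definition annulus :: "real \<Rightarrow> real \<Rightarrow> complex set" where
  "annulus r R = {z. r < norm z \<and> norm z < R}"

definition midpoint_rotation :: "complex \<Rightarrow> complex \<Rightarrow> complex \<Rightarrow> complex \<Rightarrow> bool" where
  "midpoint_rotation x y x' y' \<longleftrightarrow>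
     x' \<in> sphere (midpoint x y) (dist x (midpoint x y)) \<and>
     y' \<in> sphere (midpoint x y) (dist x (midpoint x y)) \<and>
     midpoint x' y' = midpoint x y"

text \<open>
  The rotated pairs \<open>(x\<^sub>0, y\<^sub>0)\<close> and \<open>(x\<^sub>1, y\<^sub>1)\<close> are described by relations because they are
  determined only up to some choice (for instance, \<open>x\<^sub>0\<close> and \<open>y\<^sub>0\<close> may be swapped), and because
  \<open>(x\<^sub>1, y\<^sub>1)\<close> need not exist: there is no such pair if \<open>norm k < q\<close>.
\<close>

definition equal_norm_rotation :: "complex \<Rightarrow> complex \<Rightarrow> complex \<Rightarrow> complex \<Rightarrow> bool" where
  "equal_norm_rotation x y x0 y0 \<longleftrightarrow> midpoint_rotation x y x0 y0 \<and> norm x0 = norm y0"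

definition radial_rotation :: "complex \<Rightarrow> complex \<Rightarrow> complex \<Rightarrow> complex \<Rightarrow> bool" where
  "radial_rotation x y x1 y1 \<longleftrightarrow>
     midpoint_rotation x y x1 y1 \<and>
     norm x1 = norm (midpoint x y) + dist x (midpoint x y) \<and>
     norm y1 = norm (midpoint x y) - dist x (midpoint x y)"

lemma equal_norm_rotation_norm:
  assumes "equal_norm_rotation x y x0 y0"
  shows "2 * (norm x0)\<^sup>2 = (norm x)\<^sup>2 + (norm y)\<^sup>2"
proof -
  define k where "k = midpoint x y"
  have y: "y = 2 * k - x"
    by (simp add: k_def midpoint_def scaleR_conv_of_real field_simps)
  have y0: "y0 = 2 * k - x0"
  proof -
    have "midpoint x0 y0 = k"
      using assms by (simp add: equal_norm_rotation_def midpoint_rotation_def k_def)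
    then show ?thesis
      by (auto simp: midpoint_def scaleR_conv_of_real field_simps)
  qed
  have "(dist k x0)\<^sup>2 = (dist x k)\<^sup>2" "(norm x0)\<^sup>2 = (norm y0)\<^sup>2"
    using assms by (simp_all add: equal_norm_rotation_def midpoint_rotation_def k_def)
  then show ?thesis
    unfolding y y0 dist_norm cmod_power2
    by (simp add: power2_eq_square algebra_simps)
qed

lemma equal_norm_rotation_in_annulus:
  assumes "0 \<le> r" "0 \<le> R" "x \<in> annulus r R" "y \<in> annulus r R" "equal_norm_rotation x y x0 y0"
  shows "x0 \<in> annulus r R" "y0 \<in> annulus r R"
proof -
  have eq: "2 * (norm x0)\<^sup>2 = (norm x)\<^sup>2 + (norm y)\<^sup>2"
    using assms(5) by (rule equal_norm_rotation_norm)
  have "r\<^sup>2 < (norm x)\<^sup>2" "r\<^sup>2 < (norm y)\<^sup>2" "(norm x)\<^sup>2 < R\<^sup>2" "(norm y)\<^sup>2 < R\<^sup>2"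
    using assms(1-4) by (auto simp: annulus_def intro!: power_strict_mono)
  then have "r\<^sup>2 < (norm x0)\<^sup>2" "(norm x0)\<^sup>2 < R\<^sup>2"
    using eq by linarith+
  then show "x0 \<in> annulus r R"
    using assms(1,2) by (auto simp: annulus_def dest: power_less_imp_less_base)
  then show "y0 \<in> annulus r R"
    using assms(5) by (simp add: annulus_def equal_norm_rotation_def)
qed

lemma equal_norm_rotation_exists: "\<exists>x0 y0. equal_norm_rotation x y x0 y0"
proof -
  define k q where "k = midpoint x y" and "q = dist x k"
  define u where "u = (if k = 0 then 1 else \<i> * sgn k)"
  have u: "norm u = 1"
    by (simp add: u_def norm_mult norm_sgn)
  have "norm (k + q * u) = norm (k - q * u)"
  proof (cases "k = 0")
    case False
    have eq: "k = sgn k * norm k"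
      by (simp add: complex_sgn_def scaleR_conv_of_real False)
    have k: "k + q * u = sgn k * Complex (norm k) q" "k - q * u = sgn k * Complex (norm k) (-q)"
      by (subst eq, simp add: u_def False Complex_eq algebra_simps)+
    show ?thesis
      unfolding k norm_mult by (simp add: complex_norm)
  qed simp
  moreover have "midpoint (k + q * u) (k - q * u) = k"
    by (simp add: midpoint_def scaleR_conv_of_real)
  moreover have "q \<ge> 0"
    by (simp add: q_def)
  ultimately have "equal_norm_rotation x y (k + q * u) (k - q * u)"
    using u unfolding equal_norm_rotation_def midpoint_rotation_def
      k_def[symmetric] q_def[symmetric]
    by (simp add: dist_norm norm_mult)
  then show ?thesis by blast
qed

end

theory Submission
  imports Defs
begin

text \<open>
  Up to a rotation about the origin, \<open>x\<close> and \<open>y\<close> are \<open>\<kappa> \<plusminus> q u\<close> with \<open>\<kappa> \<ge> 0\<close> and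
  \<open>norm u = 1\<close>, and the equal-norm position is \<open>u = \<i>\<close>. Only the infimum \<open>D(u)\<close> of
  \<open>f(z) = dist x z + dist z y\<close> over the two boundary circles depends on \<open>u\<close>.

  First inequality: on the outer circle, \<open>f(z)\<close> is at least the distance from \<open>x\<close> to the mirror image
  of \<open>y\<close> in the tangent at \<open>z\<close>, and conversely some boundary point is at least as good as any given
  tangent; so it suffices to compare tangents. On the inner circle, if \<open>\<kappa> \<le> r\<close> then \<open>f\<close> attains
  the trivial lower bound \<open>2q\<close>, and otherwise \<open>z = r\<close> gives \<open>f(r) \<le> 2 sqrt ((\<kappa> - r)\<^sup>2 + q\<^sup>2)\<close>
  for every \<open>u\<close>, which is a lower bound of \<open>f\<close> for \<open>u = \<i>\<close>.

  Second inequality: \<open>f(z) \<ge> 2 dist k z\<close> always, with equality in radial position for the boundary points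
  on the ray through \<open>k\<close>.

  If no radial position exists in the annulus, then turning from the equal-norm towards the radial position
  brings one of the points arbitrarily close to the boundary, unless \<open>q > \<kappa> + r\<close> and \<open>\<kappa> + q < 1\<close>; in that case the
  segment between the turned points crosses the inner disk and the ratio equals 1.
\<close>

section \<open>Boundary of the annulus and comparison of ratios\<close>

lemma exists_radial_point:
  fixes p :: complex
  assumes "p \<noteq> 0" "0 \<le> t"
  obtains z where "norm z = t" "dist p z = \<bar>norm p - t\<bar>"
proof
  have "p - of_real (t / norm p) * p = of_real ((norm p - t) / norm p) * p"
    using assms by (simp add: field_simps)
  then show "dist p (of_real (t / norm p) * p) = \<bar>norm p - t\<bar>"
    using assms by (simp only: dist_norm norm_mult norm_of_real) simp
  show "norm (of_real (t / norm p) * p) = t"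
    using assms by (simp add: norm_mult norm_divide)
qed

lemma frontier_annulus:
  assumes "0 < r" "r < R"
  shows "frontier (annulus r R) = sphere 0 r \<union> sphere 0 R"
proof
  have "open (annulus r R)"
    unfolding annulus_def by (intro open_Collect_conj open_Collect_less continuous_intros)
  moreover have "closure (annulus r R) \<subseteq> {z. r \<le> norm z \<and> norm z \<le> R}"
    by (rule closure_minimal)
      (auto simp: annulus_def intro!: closed_Collect_conj closed_Collect_le continuous_intros)
  ultimately show "frontier (annulus r R) \<subseteq> sphere 0 r \<union> sphere 0 R"
    by (auto simp: frontier_def interior_open annulus_def)
next
  have "z \<in> frontier (annulus r R)" if z: "norm z = \<rho>" "\<rho> = r \<or> \<rho> = R" for z :: complex and \<rho>
    unfolding frontier_straddle
  proof (intro allI impI conjI)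
    fix \<epsilon> :: real assume "\<epsilon> > 0"
    \<comment> \<open>Staying below \<open>R - r\<close> keeps the radial shift by
      \<open>\<delta>\<close> off one circle from reaching the other.\<close>
    define \<delta> where "\<delta> = min \<epsilon> (R - r) / 2"
    have \<delta>: "0 < \<delta>" "\<delta> < \<epsilon>" "\<delta> < R - r"
      using \<open>\<epsilon> > 0\<close> assms by (auto simp: \<delta>_def min_def field_simps)
    define t where "t = (if \<rho> = r then \<rho> + \<delta> else \<rho> - \<delta>)"
    have t: "r < t" "t < R" "\<bar>t - \<rho>\<bar> < \<epsilon>"
      using z \<delta> by (auto simp: t_def)
    have "z \<noteq> 0" "0 \<le> t"
      using z t assms by auto
    then obtain p where "norm p = t" "dist z p = \<bar>norm z - t\<bar>"
      by (rule exists_radial_point)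
    then show "\<exists>p\<in>annulus r R. dist z p < \<epsilon>"
      using t z by (intro bexI[of _ p]) (auto simp: annulus_def abs_minus_commute)
    show "\<exists>p. p \<notin> annulus r R \<and> dist z p < \<epsilon>"
      using z \<open>\<epsilon> > 0\<close> by (intro exI[of _ z]) (auto simp: annulus_def)
  qed
  then show "sphere 0 r \<union> sphere 0 R \<subseteq> frontier (annulus r R)"
    by auto
qed

lemma bdd_below_sum_dist: "bdd_below ((\<lambda>z. dist x z + dist z y) ` A)"
  by (rule bdd_belowI[of _ 0]) auto

lemma dist_le_INF_sum_dist:
  assumes "A \<noteq> {}"
  shows "dist x y \<le> (INF z\<in>A. dist x z + dist z y)"
  using assms by (intro cINF_greatest) (auto intro: dist_triangle)

text \<open>The numerators agree and the infima are positive, so only the infima need comparing. For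
  these it is enough to match each boundary point with one that is at least as good.\<close>

lemma triangular_ratio_mono:
  assumes "dist x y = dist x' y'" "x \<noteq> y" "frontier G \<noteq> {}"
    and *: "\<And>z. z \<in> frontier G \<Longrightarrow> \<exists>z'\<in>frontier G. dist x' z' + dist z' y' \<le> dist x z + dist z y"
  shows "triangular_ratio G x y \<le> triangular_ratio G x' y'"
proof -
  have "(INF z\<in>frontier G. dist x' z + dist z y') \<le> (INF z\<in>frontier G. dist x z + dist z y)"
    using assms(3) * by (intro cINF_mono bdd_below_sum_dist) auto
  moreover have "0 < (INF z\<in>frontier G. dist x' z + dist z y')"
    using dist_le_INF_sum_dist[OF assms(3), of x' y'] assms(1,2)
    by (metis zero_less_dist_iff less_le_trans)
  ultimately show ?thesis
    unfolding triangular_ratio_def assms(1) by (intro divide_left_mono) auto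
qed

text \<open>Any boundary point \<open>z\<close> traps the infimum between \<open>dist x y\<close>
  and the sum at \<open>z\<close>. Near equality in the triangle inequality at a single
  \<open>z\<close> thus forces a ratio near 1.\<close>

lemma triangular_ratio_near_1:
  assumes "x \<noteq> y" "z \<in> frontier G"
  shows "\<bar>triangular_ratio G x y - 1\<bar> \<le> (dist x z + dist z y - dist x y) / dist x y"
proof -
  define D where "D = (INF z\<in>frontier G. dist x z + dist z y)"
  have D: "dist x y \<le> D" "D \<le> dist x z + dist z y"
    unfolding D_def using assms dist_le_INF_sum_dist[of "frontier G" x y]
    by (auto intro!: cINF_lower bdd_below_sum_dist)
  have pos: "0 < dist x y" "0 < D"
    using assms D by (auto intro: less_le_trans[of 0 "dist x y"])
  have "triangular_ratio G x y - 1 = - ((D - dist x y) / D)"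
    using D pos unfolding triangular_ratio_def D_def[symmetric] by (simp add: diff_divide_distrib)
  then have "\<bar>triangular_ratio G x y - 1\<bar> = (D - dist x y) / D"
    using D pos by simp
  also have "\<dots> \<le> (dist x z + dist z y - dist x y) / dist x y"
    using D pos by (intro frac_le) auto
  finally show ?thesis .
qed

text \<open>Intermediate value theorem for the norm along the segment.\<close>

lemma segment_meets_sphere:
  fixes a b :: complex
  assumes "norm a \<le> t \<and> t \<le> norm b \<or> norm b \<le> t \<and> t \<le> norm a"
  obtains z where "norm z = t" "dist a z + dist z b = dist a b"
proof -
  have c: "connected (norm ` closed_segment a b)"
    by (intro connected_continuous_image continuous_intros) auto
  have "norm a \<in> norm ` closed_segment a b" "norm b \<in> norm ` closed_segment a b"
    by auto
  then have "t \<in> norm ` closed_segment a b"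
    using assms connectedD_interval[OF c] by blast
  then obtain z where "z \<in> closed_segment a b" "norm z = t"
    by auto
  then show thesis
    using that by (metis between between_mem_segment)
qed

section \<open>Outer circle: reflection in tangents\<close>

text \<open>
  For \<open>norm w = 1\<close> and \<open>x\<close>, \<open>y\<close> in the disk, \<open>norm (2 - x * cnj w - cnj y * w)\<close> is the
  distance from \<open>x\<close> to the mirror image of \<open>y\<close> in the tangent line of the unit circle at \<open>w\<close>.
\<close>

lemma mirror_le_sum_dist:
  assumes "norm z = 1"
  shows "norm (2 - x * cnj z - cnj y * z) \<le> dist x z + dist z y"
proof -
  have "z * cnj z = 1"
    using assms by (simp add: complex_norm_square[symmetric])
  then have "2 - x * cnj z - cnj y * z = (z - x) * cnj z + cnj (z - y) * z"
    by (simp add: algebra_simps)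
  then have "norm (2 - x * cnj z - cnj y * z) \<le> norm ((z - x) * cnj z) + norm (cnj (z - y) * z)"
    by (metis norm_triangle_ineq)
  then show ?thesis
    using assms unfolding norm_mult complex_mod_cnj by (simp add: dist_norm norm_minus_commute)
qed

text \<open>Reflection in the tangent \<open>Re = 1\<close>: a path from \<open>x\<close> to
  \<open>y\<close> via a suitable tangent point \<open>p\<close> is as long as the segment from
  \<open>x\<close> to the mirror image \<open>2 - cnj y\<close>. Since \<open>p\<close> is not
  inside the disk, the path crosses the circle before or at \<open>p\<close>, and turning to
  \<open>y\<close> there is no longer.\<close>

lemma sum_dist_le_mirror_at_1:
  assumes "norm x < 1" "norm y < 1"
  obtains z where "norm z = 1" "dist x z + dist z y \<le> norm (2 - x - cnj y)"
proof -
  define a b where "a = 1 - Re x" and "b = 1 - Re y"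
  have ab: "a > 0" "b > 0"
    using assms complex_Re_le_cmod[of x] complex_Re_le_cmod[of y] by (auto simp: a_def b_def)
  define C where "C = 2 - x - cnj y"
  have ReC: "Re C = a + b"
    by (simp add: C_def a_def b_def)
  \<comment> \<open>\<open>p\<close> is where the segment from \<open>x\<close> to
    \<open>2 - cnj y\<close> meets the tangent; \<open>a\<close> and \<open>b\<close> are the
    distances of \<open>x\<close> and \<open>y\<close> from that tangent.\<close>
  define p where "p = x + of_real (a / (a + b)) * C"
  have "Re p = Re x + a / (a + b) * Re C"
    by (simp add: p_def)
  then have "Re p = 1"
    using ab by (simp add: ReC) (simp add: a_def)
  have "cnj (p - y) = C - (p - x)"
    using \<open>Re p = 1\<close> by (simp add: C_def complex_eq_iff)
  also have "\<dots> = of_real (b / (a + b)) * C"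
  proof -
    have "1 - a / (a + b) = b / (a + b)"
      using ab by (simp add: field_simps)
    then have "of_real (b / (a + b)) * C = of_real (1 - a / (a + b)) * C"
      by simp
    then show ?thesis
      by (simp add: p_def algebra_simps)
  qed
  finally have "norm (p - y) = b / (a + b) * norm C"
    using ab by (metis complex_mod_cnj norm_mult norm_of_real abs_of_pos add_pos_pos divide_pos_pos)
  moreover have "norm (p - x) = a / (a + b) * norm C"
    using ab by (simp add: p_def norm_mult norm_divide del: of_real_divide of_real_add)
  moreover have "a / (a + b) * norm C + b / (a + b) * norm C = norm C"
    using ab by (simp add: add_divide_distrib[symmetric] distrib_right[symmetric])
  ultimately have sum: "dist x p + dist p y = norm C"
    by (simp add: dist_norm norm_minus_commute)
  have "1 \<le> norm p"
    using complex_Re_le_cmod[of p] \<open>Re p = 1\<close> by simp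
  then obtain z where z: "norm z = 1" "dist x z + dist z p = dist x p"
    using segment_meets_sphere[of x 1 p] assms by auto
  then have "dist x z + dist z y \<le> norm C"
    using sum dist_triangle[of z y p] by linarith
  then show thesis
    using that z by (simp add: C_def)
qed

lemma dist_mult_unit:
  fixes e :: "'a::real_normed_div_algebra"
  assumes "norm e = 1"
  shows "dist (e * a) (e * b) = dist a b"
  using assms by (simp add: dist_norm norm_mult flip: right_diff_distrib)

text \<open>Rotation by \<open>cnj w\<close> moves the point of tangency to 1.\<close>

lemma sum_dist_le_mirror:
  assumes "norm x < 1" "norm y < 1" "norm w = 1"
  obtains z where "norm z = 1" "dist x z + dist z y \<le> norm (2 - x * cnj w - cnj y * w)"
proof -
  have w: "w * cnj w = 1"
    using assms by (simp add: complex_norm_square[symmetric])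
  obtain z where z: "norm z = 1"
    "dist (x * cnj w) z + dist z (y * cnj w) \<le> norm (2 - x * cnj w - cnj (y * cnj w))"
    using sum_dist_le_mirror_at_1[of "x * cnj w" "y * cnj w"] assms by (auto simp: norm_mult)
  have "w * (x * cnj w) = x" "w * (y * cnj w) = y"
    using w by (simp_all add: mult.left_commute)
  then have "dist x (w * z) + dist (w * z) y = dist (x * cnj w) z + dist z (y * cnj w)"
    using dist_mult_unit[OF assms(3)] by metis
  with z assms show thesis
    by (intro that[of "w * z"]) (auto simp: norm_mult)
qed

text \<open>
  Either \<open>w\<close> can point along the line through the two points, or the given direction \<open>z\<close>,
  reflected in the real axis if necessary, already works.
\<close>

lemma exists_better_direction:
  assumes "norm u = 1" "norm z = 1"
  obtains w where "norm w = 1" "Re z \<le> Re w" "\<bar>Im (u * cnj w)\<bar> \<le> \<bar>Re z\<bar>"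
proof (cases "Re z \<le> \<bar>Re u\<bar>")
  case True
  then show thesis
    using that[of u] that[of "- u"] assms by (cases "Re u \<ge> 0") auto
next
  case False
  define a b where "a = Im u * Re z" and "b = Re u * Im z"
  have "\<bar>Im u\<bar> * Re z \<le> 1 * Re z" "\<bar>Re u\<bar> * \<bar>Im z\<bar> \<le> Re z * 1"
    using assms False abs_Im_le_cmod[of u] abs_Im_le_cmod[of z]
    by - (intro mult_mono; linarith)+
  then have "\<bar>a\<bar> \<le> Re z" "\<bar>b\<bar> \<le> Re z"
    using False by (auto simp: a_def b_def abs_mult)
  then have "\<bar>a - b\<bar> \<le> \<bar>Re z\<bar> \<or> \<bar>a + b\<bar> \<le> \<bar>Re z\<bar>"
    by linarith
  then show thesis
    using that[of z] that[of "cnj z"] assms by (auto simp: a_def b_def)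
qed

text \<open>In coordinates the mirror distance splits into a part depending on \<open>Re w\<close>
  and a part depending on \<open>Im (v * cnj w)\<close>. A better direction \<open>w\<close> makes
  neither part larger than for the equal-norm position at \<open>z\<close>.\<close>

lemma sum_dist_rotated_le_outer:
  fixes \<kappa> q :: real and u z :: complex
  assumes "0 \<le> \<kappa>" "\<kappa> \<le> 1" "norm u = 1" "norm z = 1"
    and xy: "norm (\<kappa> + q * u) < 1" "norm (\<kappa> - q * u) < 1"
  obtains z' :: complex where "norm z' = 1"
    "dist (\<kappa> + q * u) z' + dist z' (\<kappa> - q * u) \<le> dist (\<kappa> + q * \<i>) z + dist z (\<kappa> - q * \<i>)"
proof -
  have mirror: "2 - (\<kappa> + q * v) * cnj w - cnj (\<kappa> - q * v) * w
      = Complex (2 * (1 - \<kappa> * Re w)) (- 2 * q * Im (v * cnj w))" for v w :: complex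
    by (simp add: complex_eq_iff algebra_simps)
  obtain w where w: "norm w = 1" "Re z \<le> Re w" "\<bar>Im (u * cnj w)\<bar> \<le> \<bar>Re z\<bar>"
    using exists_better_direction[OF assms(3,4)] .
  obtain z' where z': "norm z' = 1" "dist (\<kappa> + q * u) z' + dist z' (\<kappa> - q * u)
      \<le> norm (2 - (\<kappa> + q * u) * cnj w - cnj (\<kappa> - q * u) * w)"
    using sum_dist_le_mirror[OF xy w(1)] .
  have "\<kappa> * Re z \<le> \<kappa> * Re w" "\<kappa> * Re w \<le> \<kappa> * 1"
    using assms(1) w complex_Re_le_cmod[of w] by - (intro mult_left_mono; simp)+
  then have "(2 * (1 - \<kappa> * Re w))\<^sup>2 \<le> (2 * (1 - \<kappa> * Re z))\<^sup>2"
    using assms(2) by (intro power_mono) auto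
  \<comment> \<open>Here \<open>Im (\<i> * cnj z)\<close> equals \<open>Re z\<close>.\<close>
  moreover have "(- 2 * q * Im (u * cnj w))\<^sup>2 \<le> (- 2 * q * Im (\<i> * cnj z))\<^sup>2"
    using w(3) unfolding abs_le_square_iff[symmetric] abs_mult by (intro mult_left_mono) auto
  ultimately have "norm (2 - (\<kappa> + q * u) * cnj w - cnj (\<kappa> - q * u) * w)
      \<le> norm (2 - (\<kappa> + q * \<i>) * cnj z - cnj (\<kappa> - q * \<i>) * z)"
    unfolding mirror complex_norm by (intro real_sqrt_le_mono add_mono)
  also have "\<dots> \<le> dist (\<kappa> + q * \<i>) z + dist z (\<kappa> - q * \<i>)"
    using assms(4) by (rule mirror_le_sum_dist)
  finally show thesis
    using that z' by (meson order_trans)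
qed

section \<open>Inner circle\<close>

lemma sum_dist_rotated_le_inner:
  fixes \<kappa> q r :: real and u z :: complex
  assumes "0 \<le> \<kappa>" "0 \<le> r" "norm u = 1" "norm z = r" "r \<le> norm (\<kappa> + q * u)"
  obtains z' :: complex where "norm z' = r"
    "dist (\<kappa> + q * u) z' + dist z' (\<kappa> - q * u) \<le> dist (\<kappa> + q * \<i>) z + dist z (\<kappa> - q * \<i>)"
proof (cases "\<kappa> \<le> r")
  case True
  \<comment> \<open>The midpoint lies in the closed inner disk and an endpoint does not lie inside
    it, so the circle meets the segment between the two points.\<close>
  then have "norm (of_real \<kappa> :: complex) \<le> r \<and> r \<le> norm (\<kappa> + q * u)"
    using assms by simp
  then obtain z' :: complex where z': "norm z' = r"
    "dist \<kappa> z' + dist z' (\<kappa> + q * u) = dist \<kappa> (\<kappa> + q * u)"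
    by (rule segment_meets_sphere[OF disjI1])
  have "dist (\<kappa> + q * u) z' + dist z' (\<kappa> - q * u)
      \<le> dist \<kappa> z' + dist z' (\<kappa> + q * u) + dist \<kappa> (\<kappa> - q * u)"
    using dist_triangle[of z' "\<kappa> - q * u" "of_real \<kappa>"] by (simp add: dist_commute)
  also have "\<dots> = 2 * \<bar>q\<bar>"
    using z'(2) assms(3) by (simp add: dist_norm norm_mult)
  also have "\<dots> = dist (\<kappa> + q * \<i>) (\<kappa> - q * \<i>)"
    by (simp add: dist_norm norm_mult flip: mult_2)
  also have "\<dots> \<le> dist (\<kappa> + q * \<i>) z + dist z (\<kappa> - q * \<i>)"
    by (rule dist_triangle)
  finally show thesis
    using that z' by blast
next
  case False
  define a b where "a = dist (\<kappa> + q * u) r" and "b = dist (of_real r) (\<kappa> - q * u)"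
  have u: "(Re u)\<^sup>2 + (Im u)\<^sup>2 = 1"
    using assms(3) by (metis cmod_power2 one_power2)
  \<comment> \<open>Parallelogram law: the sum of squares at \<open>r\<close> does not depend on the
    direction \<open>u\<close>.\<close>
  have "a\<^sup>2 + b\<^sup>2 = 2 * ((\<kappa> - r)\<^sup>2 + q\<^sup>2 * ((Re u)\<^sup>2 + (Im u)\<^sup>2))"
    unfolding a_def b_def dist_norm cmod_power2 by (simp add: power2_eq_square algebra_simps)
  then have "a\<^sup>2 + b\<^sup>2 = 2 * ((\<kappa> - r)\<^sup>2 + q\<^sup>2)"
    by (simp add: u)
  then have "(a + b)\<^sup>2 \<le> 4 * ((\<kappa> - r)\<^sup>2 + q\<^sup>2)"
    using sum_squares_bound[of a b] by (simp add: power2_sum)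
  also have "\<dots> \<le> 4 * ((\<kappa> - Re z)\<^sup>2 + q\<^sup>2)"
    using False complex_Re_le_cmod[of z] assms(4) by (intro mult_left_mono add_right_mono power_mono) auto
  \<comment> \<open>Conjugating the second vector preserves its length, cancels \<open>Im z\<close>
    and adds up the two contributions of \<open>q\<close>.\<close>
  also have "\<dots> = (norm ((\<kappa> + q * \<i> - z) + cnj (\<kappa> - q * \<i> - z)))\<^sup>2"
    unfolding cmod_power2 by (simp add: power2_eq_square algebra_simps)
  also have "\<dots> \<le> (dist (\<kappa> + q * \<i>) z + dist z (\<kappa> - q * \<i>))\<^sup>2"
    using norm_triangle_ineq[of "\<kappa> + q * \<i> - z" "cnj (\<kappa> - q * \<i> - z)"]
    unfolding complex_mod_cnj dist_norm
    by (intro power_mono) (simp_all only: norm_minus_commute norm_ge_zero)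
  finally have "a + b \<le> dist (\<kappa> + q * \<i>) z + dist z (\<kappa> - q * \<i>)"
    by (rule power2_le_imp_le) simp
  then show thesis
    using that[of "of_real r"] assms(2) by (simp add: a_def b_def)
qed

section \<open>Rotated pairs in a frame with the midpoint on the real axis\<close>

lemma midpoint_rotation_iff:
  fixes k x y :: complex and q :: real
  assumes "k = midpoint x y" "q = dist x k" "q > 0"
  shows "midpoint_rotation x y x' y' \<longleftrightarrow> (\<exists>u::complex. norm u = 1 \<and> x' = k + q * u \<and> y' = k - q * u)"
    (is "?L \<longleftrightarrow> ?R")
proof
  assume ?L
  then have *: "dist k x' = q" "midpoint x' y' = k"
    using assms by (auto simp: midpoint_rotation_def)
  have "y' = 2 * k - x'"
    using *(2) by (auto simp: midpoint_def scaleR_conv_of_real field_simps)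
  moreover have "norm ((x' - k) / q) = 1"
    using *(1) assms(3) by (simp add: norm_divide dist_norm norm_minus_commute)
  ultimately show ?R
    using assms(3) by (intro exI[of _ "(x' - k) / q"]) auto
next
  assume ?R
  then show ?L
    using assms(3) unfolding midpoint_rotation_def assms(1)[symmetric] assms(2)[symmetric]
    by (auto simp: dist_norm norm_mult midpoint_def scaleR_conv_of_real)
qed

text \<open>Law of cosines; \<open>e\<close> turns the frame into the actual position.\<close>

lemma norm_add_unit_square:
  fixes \<kappa> q :: real and e u :: complex
  assumes "norm e = 1" "norm u = 1"
  shows "(norm (e * (\<kappa> + q * u)))\<^sup>2 = \<kappa>\<^sup>2 + q\<^sup>2 + 2 * \<kappa> * q * Re u"
proof -
  have "(norm (e * (\<kappa> + q * u)))\<^sup>2 = \<kappa>\<^sup>2 + q\<^sup>2 * ((Re u)\<^sup>2 + (Im u)\<^sup>2) + 2 * \<kappa> * q * Re u"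
    unfolding norm_mult assms(1) power_mult_distrib cmod_power2
    by (simp add: power2_eq_square algebra_simps)
  also have "(Re u)\<^sup>2 + (Im u)\<^sup>2 = 1"
    using assms(2) by (metis cmod_power2 one_power2)
  finally show ?thesis
    by simp
qed

lemma unit_mult_cnj:
  assumes "norm e = 1"
  shows "e * (cnj e * u) = u"
  using assms by (simp add: complex_norm_square[symmetric] flip: mult.assoc)

text \<open>By the law of cosines, equal norms force the direction to be perpendicular to
  \<open>k\<close>. The two signs of \<open>\<i>\<close> account for swapping the points.\<close>

lemma equal_norm_rotation_frame:
  fixes k x y :: complex and q :: real
  assumes k: "k = midpoint x y" "q = dist x k" and "x \<noteq> y" and eq: "equal_norm_rotation x y x0 y0"
  obtains e :: complex where "norm e = 1" "k = e * norm k"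
    "x0 = e * (norm k + q * \<i>) \<and> y0 = e * (norm k - q * \<i>) \<or>
     y0 = e * (norm k + q * \<i>) \<and> x0 = e * (norm k - q * \<i>)"
proof -
  have "q > 0"
    using \<open>x \<noteq> y\<close> by (simp add: k dist_midpoint)
  obtain u :: complex where u: "norm u = 1" "x0 = k + q * u" "y0 = k - q * u"
    using eq midpoint_rotation_iff[OF k \<open>q > 0\<close>] by (auto simp: equal_norm_rotation_def)
  show thesis
  proof (cases "k = 0")
    case True
    then show thesis
      \<comment> \<open>A zero midpoint has no direction, so the frame is chosen to satisfy
        \<open>e * \<i> = u\<close>.\<close>
      using u by (intro that[of "- \<i> * u"]) (auto simp: norm_mult complex_eq_iff)
  next
    case False
    define e where "e = sgn k"
    have e: "norm e = 1" "k = e * norm k"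
      using False by (simp_all add: e_def norm_sgn) (simp add: complex_sgn_def scaleR_conv_of_real)
    define v where "v = cnj e * u"
    have v: "norm v = 1"
      using e u by (simp add: v_def norm_mult)
    have "u = e * v"
      unfolding v_def by (rule unit_mult_cnj[OF e(1), symmetric])
    then have xy: "x0 = e * (norm k + q * v)" "y0 = e * (norm k + q * (- v))"
      using u(2,3) e(2) by (simp_all add: algebra_simps)
    have "(norm x0)\<^sup>2 = (norm y0)\<^sup>2"
      using eq by (simp add: equal_norm_rotation_def)
    then have "norm k * q * Re v = 0"
      unfolding xy using norm_add_unit_square[of e v] norm_add_unit_square[of e "- v"] e v by simp
    then have "Re v = 0"
      using False \<open>q > 0\<close> by simp
    with v have "v = \<i> \<or> v = - \<i>"
      by (auto simp: complex_norm complex_eq_iff cmod_eq_Im)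
    then show thesis
      using that[of e] xy e by auto
  qed
qed

section \<open>Minimality of the equal-norm position\<close>

lemma triangular_ratio_equal_norm_rotation_le:
  assumes "0 < r" "r < 1" and xy: "x \<in> annulus r 1" "y \<in> annulus r 1" "x \<noteq> y"
    and eq: "equal_norm_rotation x y x0 y0"
  shows "triangular_ratio (annulus r 1) x0 y0 \<le> triangular_ratio (annulus r 1) x y"
proof -
  define k q \<kappa> where k: "k = midpoint x y" "q = dist x k" and \<kappa>: "\<kappa> = norm k"
  have "q > 0"
    using \<open>x \<noteq> y\<close> by (simp add: k dist_midpoint)
  obtain e :: complex where e: "norm e = 1" "k = e * \<kappa>"
    and x0: "x0 = e * (\<kappa> + q * \<i>) \<and> y0 = e * (\<kappa> - q * \<i>) \<or>
     y0 = e * (\<kappa> + q * \<i>) \<and> x0 = e * (\<kappa> - q * \<i>)"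
    using equal_norm_rotation_frame[OF k \<open>x \<noteq> y\<close> eq] unfolding \<kappa> by metis
  \<comment> \<open>The original pair is a rotation of itself, so it has a direction too.\<close>
  have "midpoint_rotation x y x y"
    by (simp add: midpoint_rotation_def dist_commute dist_midpoint)
  then obtain v :: complex where v: "norm v = 1" "x = k + q * v" "y = k - q * v"
    using midpoint_rotation_iff[OF k \<open>q > 0\<close>] by auto
  define u where "u = cnj e * v"
  have u: "norm u = 1" "v = e * u"
    using v e unit_mult_cnj[of e v] by (simp_all add: u_def norm_mult)
  have xy': "x = e * (\<kappa> + q * u)" "y = e * (\<kappa> - q * u)"
    using v e u by (simp_all add: algebra_simps)
  have n: "norm x = norm (\<kappa> + q * u)" "norm y = norm (\<kappa> - q * u)"
    unfolding xy' norm_mult e(1) by simp_all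
  have "\<kappa> \<le> 1"
  proof -
    have "2 * k = x + y"
      using v by simp
    then have "norm (2 * k) \<le> norm x + norm y"
      by (metis norm_triangle_ineq)
    then show ?thesis
      using xy by (simp add: norm_mult annulus_def \<kappa>)
  qed
  have F: "frontier (annulus r 1) = sphere 0 r \<union> sphere 0 1"
    using assms by (intro frontier_annulus)
  show ?thesis
  proof (rule triangular_ratio_mono)
    have "dist x0 y0 = dist (\<kappa> + q * \<i>) (\<kappa> - q * \<i>)"
      using x0 dist_mult_unit[OF e(1)] by (metis dist_commute)
    also have "\<dots> = dist (\<kappa> + q * u) (\<kappa> - q * u)"
      using u(1) by (simp add: dist_norm norm_mult flip: mult_2)
    finally show "dist x0 y0 = dist x y"
      unfolding xy' dist_mult_unit[OF e(1)] .
    then show "x0 \<noteq> y0"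
      using \<open>x \<noteq> y\<close> by auto
    show "frontier (annulus r 1) \<noteq> {}"
      unfolding F using \<open>0 < r\<close> by (auto intro!: exI[of _ 1])
  next
    fix z assume z: "z \<in> frontier (annulus r 1)"
    \<comment> \<open>Both circles are invariant under \<open>e\<close>, so the comparison can be
      made in the frame.\<close>
    define \<zeta> where "\<zeta> = cnj e * z"
    have \<zeta>: "z = e * \<zeta>" "norm \<zeta> = norm z"
      using e unit_mult_cnj[of e z] by (simp_all add: \<zeta>_def norm_mult)
    have "\<exists>z'. norm z' = norm z \<and> dist (\<kappa> + q * u) z' + dist z' (\<kappa> - q * u)
        \<le> dist (\<kappa> + q * \<i>) \<zeta> + dist \<zeta> (\<kappa> - q * \<i>)"
    proof (cases "norm z = 1")
      case True
      then show ?thesis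
        using sum_dist_rotated_le_outer[of \<kappa> u \<zeta> q] \<open>\<kappa> \<le> 1\<close> u(1) \<zeta>(2) xy n
        by (auto simp: annulus_def \<kappa>)
    next
      case False
      then have "norm z = r"
        using z by (auto simp: F)
      then show ?thesis
        using sum_dist_rotated_le_inner[of \<kappa> r u \<zeta> q] \<open>0 < r\<close> u(1) \<zeta>(2) xy n
        by (auto simp: annulus_def \<kappa>)
    qed
    then obtain z' where z': "norm z' = norm z" "dist (\<kappa> + q * u) z' + dist z' (\<kappa> - q * u)
        \<le> dist (\<kappa> + q * \<i>) \<zeta> + dist \<zeta> (\<kappa> - q * \<i>)"
      by blast
    have "dist x (e * z') + dist (e * z') y \<le> dist x0 z + dist z y0"
      using x0 z'(2) unfolding xy' \<zeta>(1) by (auto simp: dist_mult_unit[OF e(1)] dist_commute)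
    moreover have "e * z' \<in> frontier (annulus r 1)"
      using z'(1) z e(1) by (auto simp: F norm_mult)
    ultimately show "\<exists>z'\<in>frontier (annulus r 1). dist x z' + dist z' y \<le> dist x0 z + dist z y0"
      by blast
  qed
qed

section \<open>Maximality of the radial position\<close>

lemma triangular_ratio_le_radial_rotation:
  assumes "0 < r" "r < 1" "x \<noteq> y" and rad: "radial_rotation x y x1 y1"
    and x1: "x1 \<in> annulus r 1" "y1 \<in> annulus r 1"
  shows "triangular_ratio (annulus r 1) x y \<le> triangular_ratio (annulus r 1) x1 y1"
proof -
  define k q \<kappa> where k: "k = midpoint x y" "q = dist x k" and \<kappa>: "\<kappa> = norm k"
  have "q > 0"
    using \<open>x \<noteq> y\<close> by (simp add: k dist_midpoint)
  have n: "norm x1 = \<kappa> + q" "norm y1 = \<kappa> - q"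
    using rad by (simp_all add: radial_rotation_def k \<kappa>)
  then have bounds: "r < \<kappa> - q" "\<kappa> + q < 1" "\<kappa> > 0"
    using x1 \<open>q > 0\<close> \<open>0 < r\<close> by (auto simp: annulus_def)
  obtain u :: complex where u: "norm u = 1" "x1 = k + q * u" "y1 = k - q * u"
    using rad midpoint_rotation_iff[OF k \<open>q > 0\<close>] by (auto simp: radial_rotation_def)
  have "norm (k + q * u) = norm k + norm (q * u)"
    using n(1) u \<open>q > 0\<close> by (simp add: norm_mult \<kappa>)
  \<comment> \<open>Equality in the triangle inequality makes \<open>k\<close> and \<open>u\<close>
    parallel.\<close>
  then have "\<kappa> *\<^sub>R (q * u) = q *\<^sub>R k"
    using \<open>q > 0\<close> u(1) unfolding norm_triangle_eq by (simp add: norm_mult \<kappa>)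
  then have ku: "k = \<kappa> * u"
    using \<open>q > 0\<close> by (simp add: scaleR_conv_of_real)
  have xy1: "x1 = of_real (\<kappa> + q) * u" "y1 = of_real (\<kappa> - q) * u"
    using u ku by (simp_all add: algebra_simps)
  have sum1: "dist x1 (of_real t * u) + dist (of_real t * u) y1 = \<bar>\<kappa> + q - t\<bar> + \<bar>t - (\<kappa> - q)\<bar>" for t
    unfolding xy1 dist_norm left_diff_distrib[symmetric] of_real_diff[symmetric] norm_mult u(1)
      norm_of_real by simp
  have F: "frontier (annulus r 1) = sphere 0 r \<union> sphere 0 1"
    using assms by (intro frontier_annulus)
  show ?thesis
  proof (rule triangular_ratio_mono)
    have "dist x1 y1 = 2 * q"
      using u \<open>q > 0\<close> by (simp add: dist_norm norm_mult flip: mult_2)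
    also have "\<dots> = dist x y"
      unfolding k by (simp add: dist_midpoint)
    finally show "dist x y = dist x1 y1" ..
    show "frontier (annulus r 1) \<noteq> {}"
      unfolding F using \<open>0 < r\<close> by (auto intro!: exI[of _ 1])
  next
    fix z assume z: "z \<in> frontier (annulus r 1)"
    have "2 * k - 2 * z = (x - z) + (y - z)"
      by (simp add: k midpoint_def scaleR_conv_of_real)
    then have "norm (2 * (k - z)) \<le> norm (x - z) + norm (y - z)"
      by (metis norm_triangle_ineq right_diff_distrib)
    then have le: "2 * norm (k - z) \<le> dist x z + dist z y"
      unfolding norm_mult by (simp add: dist_norm norm_minus_commute)
    have "\<bar>\<kappa> - norm z\<bar> \<le> norm (k - z)"
      unfolding \<kappa> by (rule norm_triangle_ineq3)
    \<comment> \<open>Both radii lie outside the interval from \<open>\<kappa> - q\<close> to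
      \<open>\<kappa> + q\<close>, so the left side is twice the distance from
      \<open>\<kappa>\<close> to \<open>norm z\<close>.\<close>
    then have "dist x1 (of_real (norm z) * u) + dist (of_real (norm z) * u) y1 \<le> 2 * norm (k - z)"
      using z bounds \<open>q > 0\<close> unfolding sum1 by (auto simp: F)
    then show "\<exists>z'\<in>frontier (annulus r 1). dist x1 z' + dist z' y1 \<le> dist x z + dist z y"
      using z le u(1) by (intro bexI[of _ "of_real (norm z) * u"]) (auto simp: F norm_mult)
  qed fact
qed

section \<open>Ratios close to 1 without a radial position\<close>

lemma exists_midpoint_rotation_triangular_ratio_near_1:
  assumes "0 < r" "r < 1" and xy: "x \<in> annulus r 1" "y \<in> annulus r 1" "x \<noteq> y"
    and norad: "\<nexists>x1 y1. radial_rotation x y x1 y1 \<and> x1 \<in> annulus r 1 \<and> y1 \<in> annulus r 1"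
    and "\<epsilon> > 0"
  obtains x' y' where "midpoint_rotation x y x' y'" "x' \<in> annulus r 1" "y' \<in> annulus r 1"
    "\<bar>triangular_ratio (annulus r 1) x' y' - 1\<bar> < \<epsilon>"
proof -
  define k q \<kappa> where k: "k = midpoint x y" "q = dist x k" and \<kappa>: "\<kappa> = norm k"
  have "q > 0"
    using \<open>x \<noteq> y\<close> by (simp add: k dist_midpoint)
  have "\<kappa> \<ge> 0"
    by (simp add: \<kappa>)
  obtain x0 y0 where eq: "equal_norm_rotation x y x0 y0"
    using equal_norm_rotation_exists by blast
  obtain e :: complex where e: "norm e = 1" "k = e * \<kappa>"
    and x0: "x0 = e * (\<kappa> + q * \<i>) \<or> y0 = e * (\<kappa> + q * \<i>)"
    using equal_norm_rotation_frame[OF k \<open>x \<noteq> y\<close> eq] unfolding \<kappa> by metis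
  \<comment> \<open>The parameter \<open>c\<close> runs from 0, the equal-norm position, to 1, where
    the points and the origin are collinear.\<close>
  define u where "u c = Complex c (sqrt (1 - c\<^sup>2))" for c
  define X Y where "X c = e * (\<kappa> + q * u c)" and "Y c = e * (\<kappa> + q * (- u c))" for c
  \<comment> \<open>For \<open>c \<ge> 0\<close> the point \<open>X c\<close> is the outer and
    \<open>Y c\<close> the inner one, so only these two constraints can fail first.\<close>
  define g where "g c = min (1 - (\<kappa>\<^sup>2 + q\<^sup>2 + 2 * \<kappa> * q * c)) (\<kappa>\<^sup>2 + q\<^sup>2 - 2 * \<kappa> * q * c - r\<^sup>2)" for c
  have u: "norm (u c) = 1" if "0 \<le> c" "c \<le> 1" for c
    using that by (simp add: u_def complex_norm power_le_one)
  have normXY: "(norm (X c))\<^sup>2 = \<kappa>\<^sup>2 + q\<^sup>2 + 2 * \<kappa> * q * c"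
    "(norm (Y c))\<^sup>2 = \<kappa>\<^sup>2 + q\<^sup>2 - 2 * \<kappa> * q * c" if "0 \<le> c" "c \<le> 1" for c
    using norm_add_unit_square[OF e(1) u[OF that], of \<kappa> q]
      norm_add_unit_square[OF e(1), of "- u c" \<kappa> q] u[OF that]
    by (simp_all add: X_def Y_def u_def)
  have rot: "midpoint_rotation x y (X c) (Y c)" if "0 \<le> c" "c \<le> 1" for c
    unfolding midpoint_rotation_iff[OF k \<open>q > 0\<close>] using e u[OF that]
    by (intro exI[of _ "e * u c"]) (simp add: X_def Y_def norm_mult algebra_simps)
  have distXY: "dist (X c) (Y c) = 2 * q" if "0 \<le> c" "c \<le> 1" for c
    using u[OF that] \<open>q > 0\<close> unfolding X_def Y_def dist_mult_unit[OF e(1)]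
    by (simp add: dist_norm norm_mult flip: mult_2)
  have inG: "X c \<in> annulus r 1" "Y c \<in> annulus r 1" if "0 \<le> c" "c \<le> 1" "g c > 0" for c
  proof -
    have "\<kappa> * q * c \<ge> 0"
      using \<open>\<kappa> \<ge> 0\<close> \<open>q > 0\<close> that by simp
    then have "r\<^sup>2 < (norm (X c))\<^sup>2" "r\<^sup>2 < (norm (Y c))\<^sup>2"
      "(norm (X c))\<^sup>2 < 1\<^sup>2" "(norm (Y c))\<^sup>2 < 1\<^sup>2"
      using that(3) normXY[OF that(1,2)] by (simp_all add: g_def)
    then show "X c \<in> annulus r 1" "Y c \<in> annulus r 1"
      by (auto simp: annulus_def intro: power2_less_imp_less[of _ 1] power_less_imp_less_base)
  qed
  have F: "frontier (annulus r 1) = sphere 0 r \<union> sphere 0 1"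
    using assms by (intro frontier_annulus)
  note result = that
  have near: thesis if c: "0 \<le> c" "c \<le> 1" "g c > 0" and z: "norm z = r \<or> norm z = 1"
    "dist (X c) z + dist z (Y c) < 2 * q + 2 * q * \<epsilon>" for c z
  proof (rule result[OF rot[OF c(1,2)] inG[OF c]])
    have "X c \<noteq> Y c"
      using distXY[OF c(1,2)] \<open>q > 0\<close> by auto
    moreover have "z \<in> frontier (annulus r 1)"
      using z(1) by (auto simp: F)
    ultimately have "\<bar>triangular_ratio (annulus r 1) (X c) (Y c) - 1\<bar>
        \<le> (dist (X c) z + dist z (Y c) - dist (X c) (Y c)) / dist (X c) (Y c)"
      by (rule triangular_ratio_near_1)
    also have "\<dots> < \<epsilon>"
      using z(2) \<open>q > 0\<close> unfolding distXY[OF c(1,2)] by (simp add: field_simps)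
    finally show "\<bar>triangular_ratio (annulus r 1) (X c) (Y c) - 1\<bar> < \<epsilon>" .
  qed
  \<comment> \<open>A detour from a point \<open>p\<close> of the pair to a nearby \<open>z\<close>
    costs at most \<open>2 * dist p z\<close>.\<close>
  have near_frontier: "\<exists>z. norm z = t \<and> dist (X c) z + dist z (Y c) < 2 * q + 2 * q * \<epsilon>"
    if "0 \<le> c" "c \<le> 1" "p = X c \<or> p = Y c" "p \<noteq> 0" "0 \<le> t" "\<bar>norm p - t\<bar> < q * \<epsilon>" for c p t
  proof -
    obtain z where z: "norm z = t" "dist p z = \<bar>norm p - t\<bar>"
      using \<open>p \<noteq> 0\<close> \<open>0 \<le> t\<close> by (rule exists_radial_point)
    have "dist (X c) z + dist z (Y c) \<le> 2 * q + 2 * dist p z"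
      using that(3) distXY[OF that(1,2)] dist_triangle[of z "Y c" "X c"] dist_triangle[of z "X c" "Y c"]
      by (auto simp: dist_commute)
    then show ?thesis
      using that(6) z by (intro exI[of _ z]) auto
  qed
  show thesis
  proof (cases "g 1 \<le> 0")
    case True
    have "g 0 > 0"
    proof -
      have "norm x0 = norm y0" "x0 \<in> annulus r 1"
        using eq equal_norm_rotation_in_annulus[of r 1 x y x0 y0] assms
        by (auto simp: equal_norm_rotation_def)
      then have "r < norm x0" "norm x0 < 1" "norm x0 = norm (e * (\<kappa> + q * \<i>))"
        using x0 by (auto simp: annulus_def)
      moreover have "(norm (e * (\<kappa> + q * \<i>)))\<^sup>2 = \<kappa>\<^sup>2 + q\<^sup>2"
        using norm_add_unit_square[of e \<i> \<kappa> q] e by simp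
      ultimately have n: "r < norm x0" "norm x0 < 1" "\<kappa>\<^sup>2 + q\<^sup>2 = (norm x0)\<^sup>2"
        by simp_all
      have "r\<^sup>2 < (norm x0)\<^sup>2" "(norm x0)\<^sup>2 < 1"
        using n \<open>0 < r\<close> by (auto intro!: power_strict_mono simp: abs_square_less_1)
      then show ?thesis
        by (simp add: g_def n(3))
    qed
    \<comment> \<open>The factor \<open>r\<close> pays for dividing
      \<open>(norm (Y c))\<^sup>2 - r\<^sup>2\<close> by \<open>norm (Y c) + r\<close>; the bound by
      \<open>g 0\<close> allows the intermediate value theorem.\<close>
    define \<eta> where "\<eta> = min (g 0) (r * q * \<epsilon>) / 2"
    have "r * q * \<epsilon> > 0"
      using \<open>0 < r\<close> \<open>q > 0\<close> \<open>\<epsilon> > 0\<close> by simp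
    then have \<eta>: "0 < \<eta>" "\<eta> < r * q * \<epsilon>" "\<eta> \<le> g 0"
      using \<open>g 0 > 0\<close> unfolding \<eta>_def by linarith+
    have "continuous_on {0..1} g"
      unfolding g_def by (intro continuous_intros)
    then obtain c where c: "0 \<le> c" "c \<le> 1" "g c = \<eta>"
      using IVT2'[of g 1 \<eta> 0] True \<eta> by auto
    have G: "r < norm (X c)" "norm (X c) < 1" "r < norm (Y c)" "norm (Y c) < 1"
      using inG[OF c(1,2)] \<eta> c(3) by (auto simp: annulus_def)
    have rq: "r * q * \<epsilon> \<le> q * \<epsilon>"
      using \<open>r < 1\<close> \<open>q > 0\<close> \<open>\<epsilon> > 0\<close> by simp
    have "1 - (norm (X c))\<^sup>2 = \<eta> \<or> (norm (Y c))\<^sup>2 - r\<^sup>2 = \<eta>"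
      using c(3) unfolding normXY[OF c(1,2)] by (auto simp: g_def min_def split: if_splits)
    then show thesis
    proof
      assume "1 - (norm (X c))\<^sup>2 = \<eta>"
      moreover have "norm (X c) * norm (X c) \<le> norm (X c) * 1"
        using G by (intro mult_left_mono) auto
      ultimately have "\<bar>norm (X c) - 1\<bar> < q * \<epsilon>"
        using G \<eta> rq by (simp add: power2_eq_square)
      then show thesis
        using near_frontier[of c "X c" 1] near[of c] c G \<eta> \<open>0 < r\<close> by fastforce
    next
      assume Yc: "(norm (Y c))\<^sup>2 - r\<^sup>2 = \<eta>"
      have "r * (norm (Y c) - r) \<le> (norm (Y c) + r) * (norm (Y c) - r)"
        using G \<open>0 < r\<close> by (intro mult_right_mono) auto
      also have "\<dots> < r * (q * \<epsilon>)"
        using Yc \<eta> by (simp add: power2_eq_square algebra_simps)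
      finally have "\<bar>norm (Y c) - r\<bar> < q * \<epsilon>"
        using G \<open>0 < r\<close> by simp
      then show thesis
        using near_frontier[of c "Y c" r] near[of c] c G \<eta> \<open>0 < r\<close> by fastforce
    qed
  next
    case False
    have XY1: "X 1 = e * of_real (\<kappa> + q)" "Y 1 = e * of_real (\<kappa> - q)"
      by (simp_all add: X_def Y_def u_def Complex_eq)
    have norm1: "norm (X 1) = \<kappa> + q" "norm (Y 1) = \<bar>\<kappa> - q\<bar>"
      unfolding XY1 norm_mult e(1) norm_of_real using \<open>\<kappa> \<ge> 0\<close> \<open>q > 0\<close> by simp_all
    have in1: "X 1 \<in> annulus r 1" "Y 1 \<in> annulus r 1"
      using inG[of 1] False by auto
    have "\<not> r < \<kappa> - q"
    proof
      assume "r < \<kappa> - q"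
      then have "radial_rotation x y (X 1) (Y 1)"
        using rot[of 1] norm1 \<open>0 < r\<close> by (simp add: radial_rotation_def flip: k \<kappa>)
      then show False
        using norad in1 by blast
    qed
    \<comment> \<open>Here \<open>Y 1\<close> lies beyond the inner disk on the side of the origin
      opposite to \<open>X 1\<close>.\<close>
    then have "r < q - \<kappa>"
      using in1(2) norm1 by (auto simp: annulus_def)
    \<comment> \<open>The chosen point is where the segment from \<open>Y 1\<close> to
      \<open>X 1\<close> enters the inner disk.\<close>
    have "dist (X 1) (e * of_real (- r)) + dist (e * of_real (- r)) (Y 1)
        = \<bar>\<kappa> + q + r\<bar> + \<bar>- r - (\<kappa> - q)\<bar>"
      unfolding XY1 dist_mult_unit[OF e(1)] dist_of_real by (simp add: dist_real_def)
    also have "\<dots> = 2 * q"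
      using \<open>r < q - \<kappa>\<close> \<open>\<kappa> \<ge> 0\<close> \<open>q > 0\<close> \<open>0 < r\<close> by simp
    finally show thesis
      using False \<open>q > 0\<close> \<open>\<epsilon> > 0\<close> \<open>0 < r\<close> e(1)
      by (intro near[of 1 "e * of_real (- r)"]) (auto simp: norm_mult)
  qed
qed

theorem theorem3p12:
  fixes r :: real and x y x0 y0 :: complex
  assumes "0 < r" and "r < 1"
    and "x \<in> annulus r 1" and "y \<in> annulus r 1" and "x \<noteq> y"
    and "equal_norm_rotation x y x0 y0"
  shows "triangular_ratio (annulus r 1) x0 y0 \<le> triangular_ratio (annulus r 1) x y
    \<and> (\<forall>x1 y1. radial_rotation x y x1 y1 \<and> x1 \<in> annulus r 1 \<and> y1 \<in> annulus r 1 \<longrightarrow>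
         triangular_ratio (annulus r 1) x y \<le> triangular_ratio (annulus r 1) x1 y1)
    \<and> ((\<nexists>x1 y1. radial_rotation x y x1 y1 \<and> x1 \<in> annulus r 1 \<and> y1 \<in> annulus r 1) \<longrightarrow>
         (\<forall>\<epsilon>>0. \<exists>x' y'. midpoint_rotation x y x' y' \<and> x' \<in> annulus r 1 \<and> y' \<in> annulus r 1 \<and>
            \<bar>triangular_ratio (annulus r 1) x' y' - 1\<bar> < \<epsilon>))"
proof (intro conjI allI impI)
  show "triangular_ratio (annulus r 1) x0 y0 \<le> triangular_ratio (annulus r 1) x y"
    using assms by (rule triangular_ratio_equal_norm_rotation_le)
next
  fix x1 y1
  assume "radial_rotation x y x1 y1 \<and> x1 \<in> annulus r 1 \<and> y1 \<in> annulus r 1"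
  then show "triangular_ratio (annulus r 1) x y \<le> triangular_ratio (annulus r 1) x1 y1"
    using triangular_ratio_le_radial_rotation[OF assms(1,2,5)] by blast
next
  fix \<epsilon> :: real
  assume "\<nexists>x1 y1. radial_rotation x y x1 y1 \<and> x1 \<in> annulus r 1 \<and> y1 \<in> annulus r 1" "\<epsilon> > 0"
  from exists_midpoint_rotation_triangular_ratio_near_1[OF assms(1-5) this]
  show "\<exists>x' y'. midpoint_rotation x y x' y' \<and> x' \<in> annulus r 1 \<and> y' \<in> annulus r 1 \<and>
      \<bar>triangular_ratio (annulus r 1) x' y' - 1\<bar> < \<epsilon>"
    by blast
qed

end
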